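(* For every integer $n\ge 3$, the squid graph $Sq(2n-1;1^n)$ is nice.
   Context: The squid graph $Sq(2n-1;1^n)$ is obtained from the cycle $C_{2n-1}$ on vertices $u,u_1,\ldots,u_{2n-2}$ (in cyclic order) by attaching $n$ leaves $v_1,\ldots,v_n$ to the vertex $u$. A stable partition of a graph $G$ is a set partition of $V(G)$ into stable (independent) sets; its type is the partition formed by the block sizes in weakly decreasing order. For partitions of the same integer, $\mu\le\lambda$ in dominance order means $\sum_{i=1}^k\mu_i\le\sum_{i=1}^k\lambda_i$ for all $k$. A graph $G$ is nice if for any partitions $\mu\le\lambda$ in dominance order, whenever $G$ has a stable partition of type $\lambda$, it also has a stable partition of type $\mu$. *)

theory Defs
  imports "HOL-Library.Multiset" "HOL-Library.Disjoint_Sets"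
begin

(* A graph is given by a vertex set V and a set E of edges, an edge being the set of
   its two endpoints. *)
definition finite_simple_graph :: "'a set \<Rightarrow> 'a set set \<Rightarrow> bool" where
  "finite_simple_graph V E \<longleftrightarrow> finite V \<and> (\<forall>e\<in>E. e \<subseteq> V \<and> card e = 2)"

definition stable_set :: "'a set \<Rightarrow> 'a set set \<Rightarrow> 'a set \<Rightarrow> bool" where
  "stable_set V E S \<longleftrightarrow> S \<subseteq> V \<and> (\<forall>x\<in>S. \<forall>y\<in>S. {x, y} \<notin> E)"

definition stable_partition :: "'a set \<Rightarrow> 'a set set \<Rightarrow> 'a set set \<Rightarrow> bool" where
  "stable_partition V E P \<longleftrightarrow> partition_on V P \<and> (\<forall>S\<in>P. stable_set V E S)"

definition partition_type :: "'a set set \<Rightarrow> nat list" where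
  "partition_type P = rev (sorted_list_of_multiset (image_mset card (mset_set P)))"

definition has_stable_partition_of_type :: "'a set \<Rightarrow> 'a set set \<Rightarrow> nat list \<Rightarrow> bool" where
  "has_stable_partition_of_type V E lam \<longleftrightarrow> (\<exists>P. stable_partition V E P \<and> partition_type P = lam)"

definition integer_partition :: "nat \<Rightarrow> nat list \<Rightarrow> bool" where
  "integer_partition N lam \<longleftrightarrow> sorted_wrt (\<ge>) lam \<and> (\<forall>x\<in>set lam. 0 < x) \<and> sum_list lam = N"

(* For k beyond the length of a list, take k is the whole list, so that missing parts
   count as 0. *)
definition dominance_le :: "nat list \<Rightarrow> nat list \<Rightarrow> bool" where
  "dominance_le mu lam \<longleftrightarrow> (\<forall>k. sum_list (take k mu) \<le> sum_list (take k lam))"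

definition nice :: "'a set \<Rightarrow> 'a set set \<Rightarrow> bool" where
  "nice V E \<longleftrightarrow>
     (\<forall>N lam mu. integer_partition N lam \<longrightarrow> integer_partition N mu \<longrightarrow> dominance_le mu lam \<longrightarrow>
        has_stable_partition_of_type V E lam \<longrightarrow> has_stable_partition_of_type V E mu)"

(* Cyc 0 is the vertex u, Cyc i with i > 0 is the vertex u_i of the cycle,
   and Leaf j is the leaf v_j. *)
datatype squid_vertex = Cyc nat | Leaf nat

(* The squid graph Sq(m; 1^k): a cycle of length m with k leaves attached to u.
   The cycle is a simple graph for m >= 3. *)
definition squid_verts :: "nat \<Rightarrow> nat \<Rightarrow> squid_vertex set" where
  "squid_verts m k = Cyc ` {0..<m} \<union> Leaf ` {1..k}"

definition squid_edges :: "nat \<Rightarrow> nat \<Rightarrow> squid_vertex set set" where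
  "squid_edges m k =
     {{Cyc i, Cyc (Suc i mod m)} | i. i < m} \<union> {{Cyc 0, Leaf j} | j. j \<in> {1..k}}"

lemma finite_simple_graph_squid:
  assumes "m \<ge> 3"
  shows "finite_simple_graph (squid_verts m k) (squid_edges m k)"
proof -
  have "i \<noteq> Suc i mod m" if "i < m" for i
    using that assms by (cases "Suc i = m") auto
  then show ?thesis
    using assms
    by (auto simp: finite_simple_graph_def squid_verts_def squid_edges_def card_2_iff)
qed

lemma card_squid_verts: "card (squid_verts m k) = m + k"
  unfolding squid_verts_def
  by (subst card_Un_disjoint) (auto simp: card_image inj_on_def)

lemma integer_partition_partition_type:
  assumes "finite V" and "partition_on V P"
  shows "integer_partition (card V) (partition_type P)"
proof -
  have P: "finite P" "\<And>S. S \<in> P \<Longrightarrow> finite S \<and> S \<noteq> {}" "disjoint P" "\<Union>P = V"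
    using assms finite_elements[OF assms]
    by (auto simp: partition_on_def intro: finite_subset)
  have "sorted_wrt (\<ge>) (partition_type P)"
    by (simp add: partition_type_def sorted_wrt_rev)
  moreover have "\<forall>x\<in>set (partition_type P). 0 < x"
    using P by (auto simp: partition_type_def card_gt_0_iff)
  moreover have "sum_list (partition_type P) = card V"
  proof -
    have "sum_list (partition_type P) = sum_mset (mset (partition_type P))"
      by (simp only: sum_mset_sum_list)
    also have "\<dots> = sum card P"
      by (simp add: partition_type_def sum_unfold_sum_mset)
    also have "\<dots> = card (\<Union>P)"
      using P by (intro card_Union_disjoint[symmetric]) auto
    finally show ?thesis using P by simp
  qed
  ultimately show ?thesis by (simp add: integer_partition_def)
qed

end

theory Submission
  imports Defs
begin

text \<open>
  A stable set of \<open>Sq(2n-1;1^n)\<close> misses a vertex of each of the \<open>n\<close> edges of the matching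
  \<open>u v\<^sub>1\<close>, \<open>u\<^sub>1 u\<^sub>2\<close>, \<dots>, \<open>u\<^bsub>2n-3\<^esub> u\<^bsub>2n-2\<^esub>\<close>, so it has at most \<open>2n-1\<close> vertices; and there are at
  least three blocks because the cycle is odd. Both conditions on the type (largest part at most
  \<open>2n-1\<close>, at least three parts) pass to dominated partitions. Conversely they suffice: in the ordering
  \<open>u, u\<^sub>2, \<dots>, u\<^bsub>2n-2\<^esub>, v\<^sub>1, \<dots>, v\<^sub>n, u\<^sub>1, u\<^sub>3, \<dots>, u\<^bsub>2n-3\<^esub>\<close> the neighbours of \<open>u\<close> have distance at
  least \<open>n-1\<close> from \<open>u\<close>, and all other edges join vertices at distance at least \<open>2n-1\<close>. Hence cutting
  the ordering into consecutive intervals, the first one having the smallest size (at most \<open>n-1\<close>),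
  gives a stable partition.
\<close>

section \<open>Cutting a sequence into blocks of prescribed sizes\<close>

lemma partition_on_insert_block:
  assumes "partition_on W P" "finite W" "finite B" "B \<noteq> {}" "B \<inter> W = {}"
  shows "partition_on (B \<union> W) (insert B P)"
    and "image_mset card (mset_set (insert B P)) = add_mset (card B) (image_mset card (mset_set P))"
proof -
  have "finite P" using assms finite_elements by blast
  \<comment> \<open>A block of \<open>P\<close> lies in \<open>W\<close>, whereas \<open>B\<close>
    is nonempty and disjoint from \<open>W\<close>. So \<open>insert\<close> really adds a block and
    the multiset of sizes gains an entry.\<close>
  moreover have "B \<notin> P" using assms by (auto simp: partition_on_def)
  ultimately show "image_mset card (mset_set (insert B P)) =
      add_mset (card B) (image_mset card (mset_set P))" by simp
  show "partition_on (B \<union> W) (insert B P)"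
    using assms by (auto simp: partition_on_def disjoint_def)
qed

text \<open>The start \<open>a\<close> is arbitrary so that the induction can move it past the first
  interval. The endpoints of each block are recorded because its stability will depend on where it
  lies in the ordering.\<close>

lemma partition_into_intervals:
  assumes "\<forall>x\<in>set xs. 0 < x" and "inj_on f {a..<a + sum_list xs}"
  shows "\<exists>P. partition_on (f ` {a..<a + sum_list xs}) P \<and>
             image_mset card (mset_set P) = mset xs \<and>
             (\<forall>S\<in>P. \<exists>p x. S = f ` {p..<p + x} \<and> x \<in> set xs \<and> a \<le> p \<and> p + x \<le> a + sum_list xs)"
  using assms
proof (induction xs arbitrary: a)
  case Nil
  show ?case by (intro exI[of _ "{}"]) (simp add: partition_on_def)
next
  case (Cons c ys)
  let ?B = "f ` {a..<a + c}" and ?W = "f ` {a + c..<a + c + sum_list ys}"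
  have inj: "inj_on f {a..<a + c + sum_list ys}"
    using Cons.prems by (simp add: add.assoc)
  then have "inj_on f {a + c..<a + c + sum_list ys}" by (rule inj_on_subset) auto
  with Cons obtain P where P: "partition_on ?W P" "image_mset card (mset_set P) = mset ys"
    "\<forall>S\<in>P. \<exists>p x. S = f ` {p..<p + x} \<and> x \<in> set ys \<and> a + c \<le> p \<and> p + x \<le> a + c + sum_list ys"
    by (metis list.set_intros(2))
  have split: "{a..<a + c + sum_list ys} = {a..<a + c} \<union> {a + c..<a + c + sum_list ys}"
    by auto
  have disj: "?B \<inter> ?W = {}"
    using inj_on_image_Int[OF inj, of "{a..<a + c}" "{a + c..<a + c + sum_list ys}"] by auto
  have "card ?B = c"
    using inj_on_subset[OF inj, of "{a..<a + c}"] by (simp add: card_image)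
  moreover have "?B \<noteq> {}" using Cons.prems by auto
  ultimately have "partition_on (?B \<union> ?W) (insert ?B P)"
    "image_mset card (mset_set (insert ?B P)) = mset (c # ys)"
    using partition_on_insert_block[OF P(1) _ _ _ disj] P(2) by auto
  moreover have "?B \<union> ?W = f ` {a..<a + sum_list (c # ys)}"
    using split by (simp add: image_Un add.assoc)
  moreover have "\<exists>p x. S = f ` {p..<p + x} \<and> x \<in> set (c # ys) \<and> a \<le> p \<and> p + x \<le> a + sum_list (c # ys)"
    if "S \<in> insert ?B P" for S
  proof (cases "S = ?B")
    case True
    then show ?thesis by (intro exI[of _ a] exI[of _ c]) simp
  next
    case False
    with that have "S \<in> P" by simp
    from bspec[OF P(3) this] obtain p x where "S = f ` {p..<p + x}" "x \<in> set ys" "a + c \<le> p"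
      "p + x \<le> a + c + sum_list ys" by (elim exE conjE)
    then show ?thesis by (intro exI[of _ p] exI[of _ x]) simp
  qed
  ultimately show ?case by metis
qed

lemma partition_type_eqI:
  assumes "image_mset card (mset_set P) = mset lam" "sorted_wrt (\<ge>) lam"
  shows "partition_type P = lam"
proof -
  have "sorted (rev lam)" using assms(2) by (simp add: sorted_wrt_rev)
  then have "sort (rev lam) = rev lam" by (rule sorted_sort_id)
  moreover have "sorted_list_of_multiset (mset (rev lam)) = sort (rev lam)"
    by (rule sorted_list_of_multiset_mset)
  ultimately show ?thesis using assms(1) by (simp add: partition_type_def)
qed

section \<open>Adjacency, and the two necessary conditions on types\<close>

lemma squid_edges_Leaf_iff:
  "{Cyc i, Leaf j} \<in> squid_edges m k \<longleftrightarrow> i = 0 \<and> 1 \<le> j \<and> j \<le> k"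
  by (auto simp: squid_edges_def doubleton_eq_iff)

lemma squid_edges_Cyc_iff:
  "{Cyc i, Cyc j} \<in> squid_edges m k \<longleftrightarrow> i < m \<and> j = Suc i mod m \<or> j < m \<and> i = Suc j mod m"
  by (auto simp: squid_edges_def doubleton_eq_iff)

lemma squid_edges_Leaf_Leaf: "{Leaf i, Leaf j} \<notin> squid_edges m k"
  by (auto simp: squid_edges_def doubleton_eq_iff)

text \<open>The \<open>n\<close> matching edges and the \<open>n - 1\<close> leaves left over form
  \<open>2 * n - 1\<close> classes, and a stable set meets each class at most once.\<close>

lemma card_stable_set_squid:
  assumes "n \<ge> 1" and S: "stable_set (squid_verts (2 * n - 1) n) (squid_edges (2 * n - 1) n) S"
  shows "card S \<le> 2 * n - 1"
proof -
  \<comment> \<open>\<open>f\<close> numbers the classes: \<open>Cyc 0\<close> and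
    \<open>Leaf 1\<close> share 0, the other leaves get 1 to \<open>n - 1\<close>, and
    \<open>Cyc (2 * t + 1)\<close>, \<open>Cyc (2 * t + 2)\<close> share \<open>n + t\<close>, where
    \<open>t \<le> n - 2\<close>.\<close>
  define f where "f v = (case v of Cyc k \<Rightarrow> if k = 0 then 0 else n + (k - 1) div 2 | Leaf j \<Rightarrow> j - 1)" for v
  have st: "{x, y} \<notin> squid_edges (2 * n - 1) n" if "x \<in> S" "y \<in> S" for x y
    using S that by (auto simp: stable_set_def)
  have sub: "S \<subseteq> squid_verts (2 * n - 1) n" using S by (simp add: stable_set_def)
  have cyc: "i < 2 * n - 1" if "Cyc i \<in> S" for i
    using sub that by (auto simp: squid_verts_def)
  have leaf: "1 \<le> j \<and> j \<le> n" if "Leaf j \<in> S" for j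
    using sub that by (auto simp: squid_verts_def)
  have cc: "i = j" if "Cyc i \<in> S" "Cyc j \<in> S" "f (Cyc i) = f (Cyc j)" for i j
  proof (rule ccontr)
    assume "i \<noteq> j"
    \<comment> \<open>Truncated subtraction gives index 0 the same quotient as 1 and 2, so index 0
      has to be separated first.\<close>
    have "i = 0 \<longleftrightarrow> j = 0" and "(i - 1) div 2 = (j - 1) div 2"
      using that(3) assms(1) by (auto simp: f_def split: if_splits)
    with \<open>i \<noteq> j\<close> have "i = Suc j \<or> j = Suc i" by presburger
    then have "{Cyc i, Cyc j} \<in> squid_edges (2 * n - 1) n"
      using cyc[OF that(1)] cyc[OF that(2)] by (auto simp: squid_edges_Cyc_iff)
    with st that show False by blast
  qed
  have cl: False if "Cyc i \<in> S" "Leaf j \<in> S" "f (Cyc i) = f (Leaf j)" for i j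
  proof -
    have "i = 0" using that leaf[of j] by (auto simp: f_def split: if_splits)
    then show False using st[OF that(1,2)] leaf[OF that(2)] by (simp add: squid_edges_Leaf_iff)
  qed
  have ll: "i = j" if "Leaf i \<in> S" "Leaf j \<in> S" "f (Leaf i) = f (Leaf j)" for i j
    using that leaf[of i] leaf[of j] by (auto simp: f_def)
  have "inj_on f S"
  proof (rule inj_onI)
    fix x y assume "x \<in> S" "y \<in> S" "f x = f y"
    then show "x = y" using cc cl ll by (cases x; cases y) (auto, metis+)
  qed
  moreover have "f ` S \<subseteq> {..<2 * n - 1}"
  proof
    fix z assume "z \<in> f ` S"
    then obtain x where "x \<in> S" "z = f x" by blast
    then show "z \<in> {..<2 * n - 1}"
      using cyc leaf assms(1) by (cases x) (fastforce simp: f_def)+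
  qed
  ultimately have "card S \<le> card {..<2 * n - 1}" by (intro card_inj_on_le) auto
  then show ?thesis by simp
qed

text \<open>With at most two blocks, membership in the block of \<open>Cyc 0\<close> alternates
  along the cycle. As \<open>2 * n - 2\<close> is even, that block also contains the neighbour
  \<open>Cyc (2 * n - 2)\<close> of \<open>Cyc 0\<close>.\<close>

lemma card_stable_partition_squid:
  assumes "n \<ge> 2" and P: "stable_partition (squid_verts (2 * n - 1) k) (squid_edges (2 * n - 1) k) P"
  shows "card P \<ge> 3"
proof (rule ccontr)
  assume "\<not> card P \<ge> 3"
  have part: "partition_on (squid_verts (2 * n - 1) k) P"
    using P by (simp add: stable_partition_def)
  have st: "{x, y} \<notin> squid_edges (2 * n - 1) k" if "S \<in> P" "x \<in> S" "y \<in> S" for S x y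
    using P that by (auto simp: stable_partition_def stable_set_def)
  have fin: "finite P"
    by (rule finite_elements[OF _ part]) (simp add: squid_verts_def)
  have ex: "\<exists>S\<in>P. Cyc i \<in> S" if "i < 2 * n - 1" for i
  proof -
    have "Cyc i \<in> \<Union>P" using that part by (auto simp: partition_on_def squid_verts_def)
    then show ?thesis by blast
  qed
  obtain A where A: "A \<in> P" "Cyc 0 \<in> A" using ex[of 0] assms(1) by auto
  have "card (P - {A}) \<le> 1" using A fin \<open>\<not> card P \<ge> 3\<close> by simp
  \<comment> \<open>If \<open>A\<close> is the only block, \<open>B\<close> is an arbitrary
    set.\<close>
  then obtain B where "P - {A} \<subseteq> {B}"
    using fin by (metis card_le_Suc0_iff_eq finite_Diff One_nat_def insertI1 subsetI)
  then have B: "\<And>S. S \<in> P \<Longrightarrow> S \<noteq> A \<Longrightarrow> S = B" by blast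
  have alt: "Cyc i \<in> A \<longleftrightarrow> even i" if "i < 2 * n - 1" for i
    using that
  proof (induction i)
    case 0
    then show ?case using A by simp
  next
    case (Suc i)
    have e: "{Cyc i, Cyc (Suc i)} \<in> squid_edges (2 * n - 1) k"
      using Suc.prems by (simp add: squid_edges_Cyc_iff)
    obtain S T where "S \<in> P" "T \<in> P" "Cyc i \<in> S" "Cyc (Suc i) \<in> T"
      using ex[of i] ex[of "Suc i"] Suc.prems by auto
    then show ?case using Suc e st A B by (metis Suc_lessD even_Suc)
  qed
  have "Cyc (2 * n - 2) \<in> A" using alt[of "2 * n - 2"] assms(1) by auto
  moreover have "Suc (2 * n - 2) = 2 * n - 1" using assms(1) by simp
  ultimately show False
    using st[OF A(1), of "Cyc (2 * n - 2)" "Cyc 0"] A assms(1) by (simp add: squid_edges_Cyc_iff)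
qed

section \<open>The vertex ordering and its stable intervals\<close>

definition squid_order :: "nat \<Rightarrow> nat \<Rightarrow> squid_vertex" where
  "squid_order n k =
     (if k < n then Cyc (2 * k) else if k < 2 * n then Leaf (k - n + 1) else Cyc (2 * (k - 2 * n) + 1))"

lemma bij_betw_squid_order:
  assumes "n \<ge> 1"
  shows "bij_betw (squid_order n) {0..<3 * n - 1} (squid_verts (2 * n - 1) n)"
proof -
  define h where "h v = (case v of Cyc k \<Rightarrow> if even k then k div 2 else 2 * n + k div 2
                           | Leaf j \<Rightarrow> n + j - 1)" for v
  show ?thesis
  proof (rule bij_betw_byWitness[where f' = h])
    show "\<forall>k\<in>{0..<3 * n - 1}. h (squid_order n k) = k"
      by (auto simp: h_def squid_order_def)
    have "squid_order n (h (Cyc k)) = Cyc k" if "k < 2 * n - 1" for k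
      using that by (cases "even k") (auto simp: h_def squid_order_def elim!: evenE oddE)
    moreover have "squid_order n (h (Leaf j)) = Leaf j" if "j \<in> {1..n}" for j
      using that by (auto simp: h_def squid_order_def)
    ultimately show "\<forall>v\<in>squid_verts (2 * n - 1) n. squid_order n (h v) = v"
      by (auto simp: squid_verts_def)
    show "squid_order n ` {0..<3 * n - 1} \<subseteq> squid_verts (2 * n - 1) n"
      using assms by (auto simp: squid_order_def squid_verts_def)
    show "h ` squid_verts (2 * n - 1) n \<subseteq> {0..<3 * n - 1}"
      using assms by (auto simp: h_def squid_verts_def elim!: evenE oddE)
  qed
qed

text \<open>A cycle edge between an even index \<open>2 * i\<close> and an odd one joins position
  \<open>i\<close> to \<open>2 * n + i\<close> or \<open>2 * n + i - 1\<close>. The remaining edges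
  contain \<open>Cyc 0\<close>, at position 0: the closing edge ends at position
  \<open>n - 1\<close>, and the leaves start at \<open>n\<close>.\<close>

lemma squid_order_edge:
  assumes "n \<ge> 2" "i \<le> j" "j < 3 * n - 1"
    and "{squid_order n i, squid_order n j} \<in> squid_edges (2 * n - 1) n"
  shows "i = 0 \<and> n - 1 \<le> j \<or> i + (2 * n - 1) \<le> j"
proof -
  have cyc: "b = Suc a \<or> a = Suc b \<or> a = 0 \<and> b = 2 * n - 2 \<or> b = 0 \<and> a = 2 * n - 2"
    if "{Cyc a, Cyc b} \<in> squid_edges (2 * n - 1) n" for a b
  proof -
    have *: "Suc x mod (2 * n - 1) = Suc x \<or> x = 2 * n - 2 \<and> Suc x mod (2 * n - 1) = 0"
      if "x < 2 * n - 1" for x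
    proof (cases "Suc x = 2 * n - 1")
      case True
      then show ?thesis by (metis diff_Suc_1 diff_diff_left mod_self one_add_one plus_1_eq_Suc)
    qed (use that in simp)
    show ?thesis using that *[of a] *[of b] by (auto simp: squid_edges_Cyc_iff)
  qed
  consider "i < n" "j < n" | "i < n" "n \<le> j" "j < 2 * n" | "i < n" "2 * n \<le> j"
    | "n \<le> i" "i < 2 * n" "n \<le> j" "j < 2 * n" | "n \<le> i" "i < 2 * n" "2 * n \<le> j"
    | "2 * n \<le> i" "2 * n \<le> j"
    using assms(2) by linarith
  then show ?thesis
  proof cases
    case 1
    then have "{Cyc (2 * i), Cyc (2 * j)} \<in> squid_edges (2 * n - 1) n"
      using assms(4) by (simp add: squid_order_def)
    from cyc[OF this] show ?thesis using assms(1,2) by presburger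
  next
    case 2
    then have "i = 0" using assms(4) by (simp add: squid_order_def squid_edges_Leaf_iff)
    then show ?thesis using 2 by linarith
  next
    case 3
    then have "{Cyc (2 * i), Cyc (2 * (j - 2 * n) + 1)} \<in> squid_edges (2 * n - 1) n"
      using assms(4) by (simp add: squid_order_def)
    from cyc[OF this] show ?thesis using 3 assms(1,2) by linarith
  next
    case 4
    then show ?thesis using assms by (simp add: squid_order_def squid_edges_Leaf_Leaf)
  next
    case 5
    then show ?thesis using assms
      by (simp add: squid_order_def squid_edges_Leaf_iff insert_commute[of "Leaf _"])
  next
    case 6
    then obtain a b where ab: "i = 2 * n + a" "j = 2 * n + b" by (metis le_Suc_ex)
    then have "{Cyc (2 * a + 1), Cyc (2 * b + 1)} \<in> squid_edges (2 * n - 1) n"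
      using assms(4) by (simp add: squid_order_def)
    \<comment> \<open>Two odd indices are neither consecutive nor 0.\<close>
    from cyc[OF this] have False by presburger
    then show ?thesis ..
  qed
qed

text \<open>Two positions in the interval differ by at most \<open>2 * n - 2\<close>, which excludes
  the long edges. If position 0 occurs, then \<open>p = 0\<close> and the interval stops before
  position \<open>n - 1\<close>.\<close>

lemma stable_set_squid_order_interval:
  assumes "n \<ge> 2" "q \<le> 3 * n - 1" "q \<le> p + (2 * n - 1)" "p = 0 \<Longrightarrow> q \<le> n - 1"
  shows "stable_set (squid_verts (2 * n - 1) n) (squid_edges (2 * n - 1) n) (squid_order n ` {p..<q})"
proof -
  have "squid_order n ` {p..<q} \<subseteq> squid_verts (2 * n - 1) n"
    using bij_betw_squid_order[of n] assms(1,2) by (force simp: bij_betw_def)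
  moreover have le: False
    if "i \<in> {p..<q}" "j \<in> {p..<q}" "i \<le> j"
      "{squid_order n i, squid_order n j} \<in> squid_edges (2 * n - 1) n" for i j
    using squid_order_edge[OF assms(1) that(3) _ that(4)] that assms by auto
  have "{squid_order n i, squid_order n j} \<notin> squid_edges (2 * n - 1) n"
    if "i \<in> {p..<q}" "j \<in> {p..<q}" for i j
    using le[of i j] le[of j i] that
    by (cases "i \<le> j") (auto simp: insert_commute[of "squid_order n j"])
  ultimately show ?thesis unfolding stable_set_def by blast
qed

lemma squid_stable_partition_of_typeI:
  assumes n: "n \<ge> 2" and mu: "integer_partition (3 * n - 1) mu"
    and len: "length mu \<ge> 3" and le: "\<forall>x\<in>set mu. x \<le> 2 * n - 1"
  shows "has_stable_partition_of_type (squid_verts (2 * n - 1) n) (squid_edges (2 * n - 1) n) mu"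
proof -
  have "sorted (rev mu)" using mu by (simp add: integer_partition_def sorted_wrt_rev)
  moreover obtain c d e zs where xs: "rev mu = c # d # e # zs"
    using len by (metis length_rev Suc_le_length_iff numeral_3_eq_3)
  ultimately have cd: "c \<le> d" "d \<le> e" by auto
  define ys where "ys = d # e # zs"
  have xs': "rev mu = c # ys" by (simp add: xs ys_def)
  then have mu_eq: "mu = rev (c # ys)" by (metis rev_rev_ident)
  have pos: "\<forall>x\<in>set (c # ys). 0 < x" and sum: "c + sum_list ys = 3 * n - 1"
    using mu by (auto simp: mu_eq integer_partition_def)
  have "c + d + e \<le> 3 * n - 1" using sum by (simp add: ys_def)
  \<comment> \<open>Here \<open>3 * c \<le> c + d + e \<le> 3 * n - 1\<close>, hence
    \<open>c < n\<close>; this is where three parts are needed.\<close>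
  then have c: "0 < c" "c \<le> n - 1" using cd pos n by auto
  let ?f = "squid_order n"
  \<comment> \<open>The block of \<open>Cyc 0\<close> is split off, since it alone must obey the
    sharper bound \<open>n - 1\<close>.\<close>
  let ?B = "?f ` {0..<c}" and ?W = "?f ` {c..<c + sum_list ys}"
  have bij: "inj_on ?f {0..<3 * n - 1}" "?f ` {0..<3 * n - 1} = squid_verts (2 * n - 1) n"
    using bij_betw_squid_order[of n] n by (auto simp: bij_betw_def)
  have "inj_on ?f {c..<c + sum_list ys}"
    by (rule inj_on_subset[OF bij(1)]) (use sum in auto)
  then obtain P where P: "partition_on ?W P" "image_mset card (mset_set P) = mset ys"
    "\<forall>S\<in>P. \<exists>p x. S = ?f ` {p..<p + x} \<and> x \<in> set ys \<and> c \<le> p \<and> p + x \<le> c + sum_list ys"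
    using partition_into_intervals[of ys ?f c] pos by auto
  have disj: "?B \<inter> ?W = {}"
    using inj_on_image_Int[OF bij(1), of "{0..<c}" "{c..<c + sum_list ys}"] sum by auto
  have "{0..<c} \<union> {c..<c + sum_list ys} = {0..<3 * n - 1}" using sum by auto
  then have V: "?B \<union> ?W = squid_verts (2 * n - 1) n" using bij(2) by (metis image_Un)
  have "inj_on ?f {0..<c}"
    by (rule inj_on_subset[OF bij(1)]) (use sum in auto)
  then have "card ?B = c" by (simp add: card_image)
  moreover have "?B \<noteq> {}" using c by auto
  ultimately have Q: "partition_on (squid_verts (2 * n - 1) n) (insert ?B P)"
    "image_mset card (mset_set (insert ?B P)) = mset mu"
    using partition_on_insert_block[OF P(1) _ _ _ disj] P(2) V by (auto simp: mu_eq)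
  have "stable_set (squid_verts (2 * n - 1) n) (squid_edges (2 * n - 1) n) S" if "S \<in> insert ?B P" for S
  proof (cases "S = ?B")
    case True
    then show ?thesis using stable_set_squid_order_interval[of n c 0] n c by simp
  next
    case False
    with that have "S \<in> P" by simp
    from bspec[OF P(3) this] obtain p x where S: "S = ?f ` {p..<p + x}" "x \<in> set ys" "c \<le> p"
      "p + x \<le> c + sum_list ys" by (elim exE conjE)
    have "x \<le> 2 * n - 1" using le S(2) by (simp add: mu_eq)
    \<comment> \<open>Since \<open>0 < c \<le> p\<close>, position 0 is avoided and only the length
      of the interval matters.\<close>
    then show ?thesis
      unfolding S(1) using n c(1) S(3,4) sum by (intro stable_set_squid_order_interval) linarith+
  qed
  moreover have "partition_type (insert ?B P) = mu"
    using Q(2) mu by (intro partition_type_eqI) (auto simp: integer_partition_def)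
  ultimately show ?thesis
    using Q(1) unfolding has_stable_partition_of_type_def stable_partition_def by blast
qed

section \<open>Passing to dominated partitions\<close>

lemma dominance_le_length:
  assumes "integer_partition N lam" "integer_partition N mu" "dominance_le mu lam"
  shows "length lam \<le> length mu"
proof (rule ccontr)
  assume "\<not> length lam \<le> length mu"
  then have "length mu < length lam" by simp
  then have "drop (length mu) lam \<noteq> []" by simp
  moreover have "\<forall>x\<in>set (drop (length mu) lam). 0 < x"
    using assms(1) by (auto simp: integer_partition_def dest: in_set_dropD)
  ultimately have "0 < sum_list (drop (length mu) lam)"
    by (cases "drop (length mu) lam") auto
  moreover have "sum_list (take (length mu) lam) + sum_list (drop (length mu) lam) = N"
    using assms(1) by (metis append_take_drop_id integer_partition_def sum_list_append)
  \<comment> \<open>Dominance at \<open>k = length mu\<close>, where the partial sum of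
    \<open>mu\<close> is all of \<open>N\<close>; a further positive part of \<open>lam\<close>
    would exceed \<open>N\<close>.\<close>
  moreover have "N \<le> sum_list (take (length mu) lam)"
    using assms(2,3) unfolding dominance_le_def integer_partition_def
    by (metis order_refl take_all)
  ultimately show False by simp
qed

text \<open>Dominance at \<open>k = 1\<close> compares the largest parts.\<close>

lemma dominance_le_bound:
  assumes "integer_partition N mu" "dominance_le mu lam" "\<forall>x\<in>set lam. x \<le> b"
  shows "\<forall>x\<in>set mu. x \<le> b"
proof (cases mu)
  case (Cons m ms)
  have "sum_list (take 1 mu) \<le> sum_list (take 1 lam)"
    using assms(2) unfolding dominance_le_def by blast
  then have "m \<le> b" using assms(3) Cons by (cases lam) auto
  then show ?thesis using assms(1) Cons by (auto simp: integer_partition_def)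
qed simp

theorem theorem4p2:
  fixes n :: nat
  assumes "n \<ge> 3"
  shows "nice (squid_verts (2 * n - 1) n) (squid_edges (2 * n - 1) n)"
  unfolding nice_def
proof (intro allI impI)
  let ?V = "squid_verts (2 * n - 1) n" and ?E = "squid_edges (2 * n - 1) n"
  fix N lam mu
  assume lam: "integer_partition N lam" and mu: "integer_partition N mu"
    and dom: "dominance_le mu lam" and "has_stable_partition_of_type ?V ?E lam"
  then obtain P where P: "stable_partition ?V ?E P" and type: "partition_type P = lam"
    unfolding has_stable_partition_of_type_def by blast
  have part: "partition_on ?V P" using P by (simp add: stable_partition_def)
  have fin: "finite ?V" by (simp add: squid_verts_def)
  have "finite P" using finite_elements[OF fin part] .
  have "integer_partition (card ?V) lam"
    using integer_partition_partition_type[OF fin part] type by simp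
  \<comment> \<open>\<open>lam\<close> sums to \<open>N\<close> by assumption and to the number of
    vertices as the type of \<open>P\<close>.\<close>
  then have N: "N = 3 * n - 1"
    using lam assms by (simp add: integer_partition_def card_squid_verts)
  have mset_lam: "mset lam = image_mset card (mset_set P)"
    using type by (auto simp: partition_type_def)
  have "length lam = card P"
    by (metis mset_lam size_image_mset size_mset size_mset_set)
  then have "3 \<le> length lam" using card_stable_partition_squid[OF _ P] assms by simp
  then have "3 \<le> length mu" using dominance_le_length[OF lam mu dom] by simp
  moreover have "set lam = card ` P"
    using \<open>finite P\<close> by (metis mset_lam finite_set_mset_mset_set set_image_mset set_mset_mset)
  then have "\<forall>x\<in>set lam. x \<le> 2 * n - 1"
    using P card_stable_set_squid[of n] assms by (auto simp: stable_partition_def)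
  then have "\<forall>x\<in>set mu. x \<le> 2 * n - 1" using dominance_le_bound[OF mu dom] by blast
  ultimately show "has_stable_partition_of_type ?V ?E mu"
    using squid_stable_partition_of_typeI[of n mu] mu assms N by simp
qed

end
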